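(* Consider the CODA dynamics on the complete graph on $n\ge2$ agents. If $n^-(0)>n^+(0)$, then $\displaystyle\lim_{k\to\infty}p_i(k)=0$ for all $i\in\mathcal{V}$. Reversely, if $n^+(0)>n^-(0)$, then $\displaystyle\lim_{k\to\infty}p_i(k)=1$ for all $i\in\mathcal{V}$.
   Context: $\mathcal{V}=\{1,\dots,n\}$ is the set of agents; the interaction graph is complete, i.e. the set of agents influencing $i$ is $N_i=\mathcal{V}\setminus\{i\}$, and $n_i=|N_i|=n-1$. Time is $k\in\mathbb{N}=\{0,1,2,\dots\}$. Each agent has an opinion $p_i(k)$, with initial opinions $p_i(0)\in(0,1)$, $p_i(0)\ne\frac12$, and an action $q_i(k)\in\{0,1\}$ defined by: $q_i(k)=0$ if $p_i(k)<\frac12$; $q_i(k)=0$ if $p_i(k)=\frac12$ and $p_i(k-1)<\frac12$; $q_i(k)=1$ otherwise. The CODA (continuous opinions, discrete actions) dynamics is $$p_i(k+1)=p_i(k)+\frac{p_i(k)(1-p_i(k))}{n_i}\sum_{j\in N_i}(q_j(k)-p_i(k)),\qquad i\in\mathcal{V},\ k\in\mathbb{N}.$$ $n^-(k)$ and $n^+(k)$ denote the numbers of agents $i\in\mathcal{V}$ with $q_i(k)=0$ and $q_i(k)=1$, respectively. *)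

theory Defs
  imports Complex_Main
begin

text \<open>
  An opinion trajectory is a function \<open>p\<close>, with \<open>p i k\<close> the opinion of agent \<open>i\<close> at time \<open>k\<close>.
  An interaction graph is a vertex set \<open>V\<close> with a function \<open>N\<close>, where \<open>N i\<close> is the set of
  agents influencing \<open>i\<close>.
\<close>

text \<open>
  The guard \<open>0 < k\<close> is there because \<open>0 - 1 = 0\<close> on naturals. At time \<open>0\<close> the tie-breaking
  clause never matters, since initial opinions differ from \<open>1/2\<close>.
\<close>

definition action :: "('a \<Rightarrow> nat \<Rightarrow> real) \<Rightarrow> 'a \<Rightarrow> nat \<Rightarrow> nat" where
  "action p i k =
     (if p i k < 1/2 then 0
      else if p i k = 1/2 \<and> 0 < k \<and> p i (k - 1) < 1/2 then 0
      else 1)"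

definition coda_dynamics :: "'a set \<Rightarrow> ('a \<Rightarrow> 'a set) \<Rightarrow> ('a \<Rightarrow> nat \<Rightarrow> real) \<Rightarrow> bool" where
  "coda_dynamics V N p \<longleftrightarrow>
     (\<forall>i\<in>V. 0 < p i 0 \<and> p i 0 < 1 \<and> p i 0 \<noteq> 1/2) \<and>
     (\<forall>i\<in>V. \<forall>k. p i (Suc k) =
        p i k + p i k * (1 - p i k) / real (card (N i)) *
          (\<Sum>j\<in>N i. (real (action p j k) - p i k)))"

definition agents :: "nat \<Rightarrow> nat set" where
  "agents n = {1..n}"

definition complete_nbrs :: "nat \<Rightarrow> nat \<Rightarrow> nat set" where
  "complete_nbrs n i = agents n - {i}"

definition n_minus :: "'a set \<Rightarrow> ('a \<Rightarrow> nat \<Rightarrow> real) \<Rightarrow> nat \<Rightarrow> nat" where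
  "n_minus V p k = card {i \<in> V. action p i k = 0}"

definition n_plus :: "'a set \<Rightarrow> ('a \<Rightarrow> nat \<Rightarrow> real) \<Rightarrow> nat \<Rightarrow> nat" where
  "n_plus V p k = card {i \<in> V. action p i k = 1}"

end

theory Submission
  imports Defs
begin

text \<open>
  Let \<open>S\<close> be the agents whose initial opinion lies strictly on the majority side, say below
  \<open>1/2\<close>. Since \<open>S\<close> has more than half of the agents, the average action seen by anyone is at
  most \<open>1/2\<close>, and an opinion below a level \<open>d\<close> stays below \<open>d\<close> as long as the average it sees is
  at most \<open>d\<close>; hence \<open>S\<close> never leaves. An agent outside \<open>S\<close> does not count itself, so it always
  sees an average at most some \<open>c < 1/2\<close>, and its opinion decreases at a rate bounded away from
  zero until it is below \<open>1/2\<close>. After finitely many steps all actions are \<open>0\<close> and all opinions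
  decay to \<open>0\<close>. Tie-breaking at \<open>1/2\<close> is irrelevant to this argument, so the other case follows
  by replacing \<open>p\<close> with \<open>1 - p\<close>.
\<close>

text \<open>One update of an agent with opinion \<open>x\<close> whose neighbours have mean action
  \<open>a\<close>.\<close>

definition coda_step :: "real \<Rightarrow> real \<Rightarrow> real" where
  "coda_step a x = x + x * (1 - x) * (a - x)"

lemma coda_step_bounds:
  assumes "0 < x" "x < 1" "0 \<le> a" "a \<le> 1"
  shows "0 < coda_step a x" "coda_step a x < 1"
proof -
  have "(1 - x) * (x - a) < 1"
  proof -
    have "(1 - x) * (x - a) \<le> (1 - x) * 1"
      using assms by (intro mult_left_mono) auto
    also have "\<dots> < 1"
      using assms by simp
    finally show ?thesis .
  qed
  then have "0 < x * (1 - (1 - x) * (x - a))"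
    using assms by simp
  also have "\<dots> = coda_step a x"
    by (simp add: coda_step_def algebra_simps)
  finally show "0 < coda_step a x" .
  have "x * (a - x) < 1"
  proof -
    have "x * (a - x) \<le> x * 1"
      using assms by (intro mult_left_mono) auto
    also have "\<dots> < 1"
      using assms by simp
    finally show ?thesis .
  qed
  then have "0 < (1 - x) * (1 - x * (a - x))"
    using assms by simp
  also have "\<dots> = 1 - coda_step a x"
    by (simp add: coda_step_def algebra_simps)
  finally show "coda_step a x < 1" by simp
qed

text \<open>The step covers only a fraction \<open>x * (1 - x) < 1\<close> of the way from
  \<open>x\<close> to \<open>a\<close>, so it cannot overshoot to \<open>d\<close>.\<close>

lemma coda_step_less:
  assumes "0 < x" "x < 1" "x < d" "a \<le> d"
  shows "coda_step a x < d"
proof -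
  have "x * (1 - x) < 1 * 1"
    using assms by (intro mult_strict_mono) auto
  then have "0 < (d - x) * (1 - x * (1 - x))"
    using assms by simp
  moreover have "x * (1 - x) * (a - x) \<le> x * (1 - x) * (d - x)"
    using assms by (intro mult_left_mono) auto
  ultimately show ?thesis
    by (simp add: coda_step_def algebra_simps)
qed

text \<open>Bounding the factors \<open>x\<close>, \<open>1 - x\<close> and \<open>x - a\<close>
  separately gives a decrease that is uniform over \<open>x\<close> between \<open>d\<close> and
  \<open>y\<close>.\<close>

lemma coda_step_drop:
  assumes "0 < d" "d \<le> x" "x \<le> y" "y < 1" "a \<le> c" "c < d"
  shows "coda_step a x \<le> x - d * (1 - y) * (d - c)"
proof -
  have "d * (1 - y) * (d - c) \<le> x * (1 - x) * (x - a)"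
    using assms by (intro mult_mono) auto
  then show ?thesis
    by (simp add: coda_step_def algebra_simps)
qed

text \<open>Serves twice: with \<open>d = 1/2\<close> to bring the minority across, and with
  arbitrarily small \<open>d\<close> to obtain the limit.\<close>

lemma eventually_less_if_eventually_mean_le:
  fixes x a :: "nat \<Rightarrow> real"
  assumes step: "\<And>k. x (Suc k) = coda_step (a k) (x k)"
    and bounds: "\<And>k. 0 < x k" "\<And>k. x k < 1"
    and ev: "\<forall>\<^sub>F k in sequentially. a k \<le> c"
    and cd: "c < d" "0 < d"
  shows "\<forall>\<^sub>F k in sequentially. x k < d"
proof -
  obtain K where K: "\<And>k. k \<ge> K \<Longrightarrow> a k \<le> c"
    using ev by (auto simp: eventually_sequentially)
  have "\<exists>k\<ge>K. x k < d"
  proof (rule ccontr)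
    assume "\<not> ?thesis"
    then have ge: "d \<le> x k" if "k \<ge> K" for k
      using that by force
    \<comment> \<open>The starting value \<open>x K\<close> acts as the upper bound \<open>y\<close>
      of \<open>coda_step_drop\<close>; the induction below shows that the trajectory never exceeds
      it.\<close>
    define \<delta> where "\<delta> = d * (1 - x K) * (d - c)"
    have pos: "\<delta> > 0"
      using cd bounds(2)[of K] by (simp add: \<delta>_def)
    have drop: "x (K + m) \<le> x K - real m * \<delta>" for m
    proof (induction m)
      case (Suc m)
      have "0 \<le> real m * \<delta>"
        using pos by simp
      then have "x (K + m) \<le> x K"
        using Suc by linarith
      then have "x (Suc (K + m)) \<le> x (K + m) - \<delta>"
        unfolding step \<delta>_def using ge K bounds cd by (intro coda_step_drop) auto
      with Suc show ?case
        by (simp add: algebra_simps)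
    qed simp
    \<comment> \<open>A total drop above 1 would make an opinion that started below 1
      negative.\<close>
    obtain m where "1 < real m * \<delta>"
      using reals_Archimedean3[OF pos] by blast
    with drop[of m] bounds(1)[of "K + m"] bounds(2)[of K] show False
      by linarith
  qed
  then obtain L where L: "L \<ge> K" "x L < d" by blast
  have "x k < d" if "k \<ge> L" for k
    using that
  proof (induction rule: dec_induct)
    case (step k)
    then show ?case
      unfolding assms(1) using bounds K[of k] L(1) cd by (intro coda_step_less) auto
  qed (rule L(2))
  then show ?thesis
    by (auto simp: eventually_sequentially)
qed

lemma sum_others_le_card:
  fixes f :: "'a \<Rightarrow> real"
  assumes "finite V" "\<And>j. j \<in> V \<Longrightarrow> f j \<le> 1" "\<And>j. j \<in> S \<Longrightarrow> f j = 0"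
  shows "sum f (V - {i}) \<le> real (card (V - S - {i}))"
proof -
  have "sum f (V - {i}) = sum f (V - S - {i})"
    using assms by (intro sum.mono_neutral_right) auto
  also have "\<dots> \<le> (\<Sum>j\<in>V - S - {i}. 1)"
    using assms by (intro sum_mono) auto
  finally show ?thesis by simp
qed

text \<open>\<open>b\<close> replaces \<open>action\<close> and is prescribed only below 1/2, so
  that the reflected pair \<open>1 - p\<close>, \<open>1 - b\<close> fits as well.\<close>

lemma majority_below_tendsto_0:
  fixes p b :: "'a \<Rightarrow> nat \<Rightarrow> real"
  assumes fin: "finite V" and two: "card V \<ge> 2"
    and init: "\<And>i. i \<in> V \<Longrightarrow> 0 < p i 0" "\<And>i. i \<in> V \<Longrightarrow> p i 0 < 1"
    and dyn: "\<And>i k. i \<in> V \<Longrightarrow> p i (Suc k) =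
        p i k + p i k * (1 - p i k) / real (card (V - {i})) * (\<Sum>j\<in>V - {i}. b j k - p i k)"
    and b01: "\<And>i k. 0 \<le> b i k" "\<And>i k. b i k \<le> 1"
    and b0: "\<And>i k. p i k < 1/2 \<Longrightarrow> b i k = 0"
    and maj: "2 * card {i \<in> V. p i 0 < 1/2} > card V"
    and "i \<in> V"
  shows "(\<lambda>k. p i k) \<longlonglongrightarrow> 0"
proof -
  define S where "S = {i \<in> V. p i 0 < 1/2}"
  define a where "a i k = (\<Sum>j\<in>V - {i}. b j k) / real (card V - 1)" for i k
  have S: "S \<subseteq> V" "2 * card S > card V"
    using maj by (auto simp: S_def)
  have card_VS: "card (V - S) = card V - card S" "card S \<le> card V"
    using S fin by (auto simp: card_Diff_subset card_mono finite_subset)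
  have step: "p i (Suc k) = coda_step (a i k) (p i k)" if "i \<in> V" for i k
    using that two fin
    by (simp add: dyn[OF that] coda_step_def a_def sum_subtractf field_simps)
  have a01: "0 \<le> a i k" "a i k \<le> 1" if "i \<in> V" for i k
  proof -
    show "0 \<le> a i k"
      using b01 by (simp add: a_def sum_nonneg)
    have "(\<Sum>j\<in>V - {i}. b j k) \<le> real (card V - 1)"
      using sum_others_le_card[of V "\<lambda>j. b j k" "{}" i] that fin b01 by simp
    then show "a i k \<le> 1"
      using two by (simp add: a_def)
  qed
  have p01: "0 < p i k \<and> p i k < 1" if "i \<in> V" for i k
    using that
    by (induction k) (use init coda_step_bounds a01 in \<open>auto simp: step\<close>)
  have a_le: "a i k \<le> real (card (V - S - {i})) / real (card V - 1)"
    if "\<And>j. j \<in> S \<Longrightarrow> p j k < 1/2" for i k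
    unfolding a_def using that fin b01 b0
    by (intro divide_right_mono sum_others_le_card) auto
  have S_stays: "\<forall>i\<in>S. p i k < 1/2" for k
  proof (induction k)
    case (Suc k)
    show ?case
    proof
      fix i assume i: "i \<in> S"
      \<comment> \<open>Removing \<open>i\<close> changes nothing here, as \<open>i\<close> lies in
        \<open>S\<close>; the strict majority of \<open>S\<close> yields the
        \<open>- 1\<close>.\<close>
      have "2 * card (V - S - {i}) \<le> card V - 1"
        using i S card_VS by simp
      then have "real (card (V - S - {i})) / real (card V - 1) \<le> 1/2"
        using two by (simp add: field_simps)
      then have "a i k \<le> 1/2"
        using a_le[of k i] Suc by (meson order_trans)
      then show "p i (Suc k) < 1/2"
        using i Suc S p01 by (subst step; (intro coda_step_less)?) auto
    qed
  qed (simp add: S_def)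
  have ev_half: "\<forall>\<^sub>F k in sequentially. p j k < 1/2" if j: "j \<in> V" for j
  proof (cases "j \<in> S")
    case False
    define c where "c = real (card (V - S - {j})) / real (card V - 1)"
    \<comment> \<open>Now \<open>j\<close> itself is removed from \<open>V - S\<close>, which makes
      the inequality strict and leaves a gap between \<open>c\<close> and 1/2.\<close>
    have "2 * card (V - S - {j}) < card V - 1"
      using j False S card_VS fin two
      by (subst card_Diff_singleton) auto
    then have "c < 1/2"
      using two by (simp add: c_def field_simps)
    moreover have "a j k \<le> c" for k
      unfolding c_def using S_stays by (intro a_le) auto
    ultimately show ?thesis
      using eventually_less_if_eventually_mean_le[of "p j" "a j" c "1/2"] step p01 j by auto
  qed (use S_stays in auto)
  then have "\<forall>\<^sub>F k in sequentially. \<forall>j\<in>V. p j k < 1/2"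
    using fin by (simp add: eventually_ball_finite)
  then have "\<forall>\<^sub>F k in sequentially. a i k \<le> 0"
    by eventually_elim (use b0 in \<open>simp add: a_def\<close>)
  then have "\<forall>\<^sub>F k in sequentially. p i k < e" if "e > 0" for e
    using eventually_less_if_eventually_mean_le[of "p i" "a i" 0 e] step p01 \<open>i \<in> V\<close> that by auto
  moreover have "e < p i k" if "e < 0" for e k
    using p01[OF \<open>i \<in> V\<close>, of k] that by linarith
  ultimately show ?thesis
    by (auto intro!: order_tendstoI)
qed

theorem proposition11:
  fixes n :: nat and p :: "nat \<Rightarrow> nat \<Rightarrow> real"
  assumes "n \<ge> 2"
    and "coda_dynamics (agents n) (complete_nbrs n) p"
  shows "(n_minus (agents n) p 0 > n_plus (agents n) p 0 \<longrightarrow>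
            (\<forall>i\<in>agents n. (\<lambda>k. p i k) \<longlonglongrightarrow> 0)) \<and>
         (n_plus (agents n) p 0 > n_minus (agents n) p 0 \<longrightarrow>
            (\<forall>i\<in>agents n. (\<lambda>k. p i k) \<longlonglongrightarrow> 1))"
proof -
  let ?V = "agents n"
  define b where "b i k = real (action p i k)" for i k
  have V: "finite ?V" "card ?V = n"
    by (simp_all add: agents_def)
  have init: "0 < p i 0" "p i 0 < 1" "p i 0 \<noteq> 1/2" if "i \<in> ?V" for i
    using assms(2) that by (auto simp: coda_dynamics_def)
  have dyn: "p i (Suc k) = p i k + p i k * (1 - p i k) / real (card (?V - {i})) *
      (\<Sum>j\<in>?V - {i}. b j k - p i k)" if "i \<in> ?V" for i k
    using assms(2) that by (auto simp: coda_dynamics_def complete_nbrs_def b_def)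
  have b01: "0 \<le> b i k" "b i k \<le> 1" for i k
    by (auto simp: b_def action_def)
  have b_below: "b i k = 0" if "p i k < 1/2" for i k
    using that by (simp add: b_def action_def)
  have b_above: "b i k = 1" if "p i k > 1/2" for i k
    using that by (simp add: b_def action_def)
  have minus: "n_minus ?V p 0 = card {i \<in> ?V. p i 0 < 1/2}"
    unfolding n_minus_def by (rule arg_cong[where f = card]) (auto simp: action_def)
  have plus: "n_plus ?V p 0 = card {i \<in> ?V. 1 - p i 0 < 1/2}"
    unfolding n_plus_def by (rule arg_cong[where f = card])
      (use init in \<open>force simp: action_def\<close>)
  \<comment> \<open>No initial opinion equals 1/2, so the two camps partition the agents and the
    larger one has more than \<open>n / 2\<close> members.\<close>
  have "{i \<in> ?V. p i 0 < 1/2} \<union> {i \<in> ?V. 1 - p i 0 < 1/2} = ?V"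
    using init by force
  then have total: "n_minus ?V p 0 + n_plus ?V p 0 = n"
    unfolding minus plus using V
    by (subst card_Un_disjoint[symmetric]) auto
  have "(\<lambda>k. p i k) \<longlonglongrightarrow> 0" if "n_minus ?V p 0 > n_plus ?V p 0" "i \<in> ?V" for i
    by (rule majority_below_tendsto_0[where V = ?V and b = b])
      (use V assms(1) init dyn b01 b_below total minus that in auto)
  moreover have "(\<lambda>k. p i k) \<longlonglongrightarrow> 1" if "n_plus ?V p 0 > n_minus ?V p 0" "i \<in> ?V" for i
  proof -
    \<comment> \<open>Under the reflection \<open>p * (1 - p)\<close> is invariant, while the sum
      and the increment both change sign.\<close>
    have dyn': "1 - p i (Suc k) = (1 - p i k) +
        (1 - p i k) * (1 - (1 - p i k)) / real (card (?V - {i})) *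
        (\<Sum>j\<in>?V - {i}. (1 - b j k) - (1 - p i k))" if "i \<in> ?V" for i k
    proof -
      have "(\<Sum>j\<in>?V - {i}. (1 - b j k) - (1 - p i k)) = - (\<Sum>j\<in>?V - {i}. b j k - p i k)"
        by (simp flip: sum_negf)
      then show ?thesis
        by (simp add: dyn[OF that] mult.commute)
    qed
    have "(\<lambda>k. 1 - p i k) \<longlonglongrightarrow> 0"
      by (rule majority_below_tendsto_0[where V = ?V and b = "\<lambda>j k. 1 - b j k"
            and p = "\<lambda>j k. 1 - p j k"])
        (use V assms(1) init dyn' b01 b_above total plus that in auto)
    from tendsto_diff[OF tendsto_const[of 1] this] show ?thesis
      by simp
  qed
  ultimately show ?thesis by blast
qed

end
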